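(* Let $\Phi=\{\phi_i\}_{i\in\mathcal{D}}$ be a conformal iterated function system satisfying the open set condition, with attractor $X\subset\mathbb{R}^d$, and let $H$ be a height function on a set $E\subset\mathbb{R}^d$. Suppose $E\cap X\neq\emptyset$ and $\Phi$ respects $E$ and $H$. Then for any $l>0$ we have $$\dim_{H}\Big(\Big\{x\in X: |x-e|<H(e)^{-l}\text{ for infinitely many } e\in E\Big\}\Big)>0.$$
   Context: A map $\phi:V\to V$ on a closed set $V\subset\mathbb{R}^d$ is a contraction if there exists $r\in(0,1)$ with $|\phi(x)-\phi(y)|\le r|x-y|$ for all $x,y\in V$. An iterated function system (IFS) is a finite set of contractions $\Phi=\{\phi_i\}_{i\in\mathcal{D}}$ on a closed subset of $\mathbb{R}^d$; its attractor is the unique non-empty compact set $X$ with $X=\bigcup_{i\in\mathcal{D}}\phi_i(X)$. $\dim_H$ (applied to a set) denotes Hausdorff dimension. A height function on a set $E\subset\mathbb{R}^d$ is any function $H:E\to\mathbb{R}_{>0}$. $\Phi$ respects $E$ and $H$ if: (i) $\phi(x)\in E$ for all $x\in E$ and $\phi\in\Phi$; (ii) there exists $C>1$ such that $H(\phi(x))<C\,H(x)$ for all $x\in E$ and $\phi\in\Phi$. Conformal IFS: an IFS $\Phi$ on a compact set $Y\subset\mathbb{R}^d$ such that each $\phi_i$ can be extended to an injective conformal contraction on some open connected neighbourhood $V$ containing $Y$ (conformal: $C^1$ with $|\phi_i'(x)y|=|\phi_i'(x)||y|$ for all $x\in V$, $y\in\mathbb{R}^d$), with $0<\inf_{x\in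 V}|\phi_i'(x)|\le\sup_{x\in V}|\phi_i'(x)|<1$, and such that the differentials are Hölder continuous: for some $\alpha,c>0$, $||\phi_i'(x)|-|\phi_i'(y)||\le c|x-y|^\alpha$ for all $x,y\in V$. Open set condition: there is a non-empty open set $O\subset\mathbb{R}^d$ with $\phi_i(O)\subset O$ for all $i\in\mathcal{D}$ and $\phi_i(O)\cap\phi_j(O)=\emptyset$ for all $i\ne j$.
   Formalization: The iterated function system is assumed to contain at least two maps; for a single contraction the attractor is one point, so the set has Hausdorff dimension 0 and the claim as stated fails. *)

theory Defs
  imports "HOL-Analysis.Analysis"
begin

definition contraction_on :: "'a::metric_space set \<Rightarrow> ('a \<Rightarrow> 'a) \<Rightarrow> bool" where
  "contraction_on V f \<longleftrightarrow>
     f ` V \<subseteq> V \<and> (\<exists>r. 0 < r \<and> r < 1 \<and> (\<forall>x\<in>V. \<forall>y\<in>V. dist (f x) (f y) \<le> r * dist x y))"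

definition ifs_on :: "'a::metric_space set \<Rightarrow> 'i set \<Rightarrow> ('i \<Rightarrow> 'a \<Rightarrow> 'a) \<Rightarrow> bool" where
  "ifs_on Y D \<phi> \<longleftrightarrow> closed Y \<and> finite D \<and> (\<forall>i\<in>D. contraction_on Y (\<phi> i))"

text \<open>The inclusion in \<open>Y\<close> is needed because the maps are total functions whose values are
  only meaningful on \<open>Y\<close>. By Hutchinson's theorem at most one set satisfies this predicate.\<close>

definition attractor_on ::
  "'a::metric_space set \<Rightarrow> 'i set \<Rightarrow> ('i \<Rightarrow> 'a \<Rightarrow> 'a) \<Rightarrow> 'a set \<Rightarrow> bool" where
  "attractor_on Y D \<phi> X \<longleftrightarrow>
     X \<noteq> {} \<and> compact X \<and> X \<subseteq> Y \<and> X = (\<Union>i\<in>D. \<phi> i ` X)"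

text \<open>On an open set \<open>V\<close> the derivative \<open>f'\<close> is determined by \<open>f\<close>. The norm of a bounded linear
  map is its operator norm, so continuity of \<open>f'\<close> is the usual \<open>C\<^sup>1\<close> condition.\<close>

definition conformal_on ::
  "'a::euclidean_space set \<Rightarrow> ('a \<Rightarrow> 'a) \<Rightarrow> ('a \<Rightarrow> 'a \<Rightarrow>\<^sub>L 'a) \<Rightarrow> bool" where
  "conformal_on V f f' \<longleftrightarrow>
     (\<forall>x\<in>V. (f has_derivative blinfun_apply (f' x)) (at x)) \<and>
     continuous_on V f' \<and>
     (\<forall>x\<in>V. \<forall>y. norm (blinfun_apply (f' x) y) = norm (f' x) * norm y)"

text \<open>A conformal IFS on the compact set \<open>Y\<close>: the total function \<open>\<phi> i\<close> stands both for the map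
  on \<open>Y\<close> and for its extension to the neighbourhood \<open>V i\<close>, which may depend on \<open>i\<close>; a common
  neighbourhood is the case where \<open>V\<close> is constant. The infimum and supremum are taken over a
  non-empty set when \<open>Y\<close> is non-empty, and the contraction property bounds the derivative norms
  above.\<close>

definition conformal_ifs ::
  "'a::euclidean_space set \<Rightarrow> ('i \<Rightarrow> 'a set) \<Rightarrow> 'i set \<Rightarrow> ('i \<Rightarrow> 'a \<Rightarrow> 'a) \<Rightarrow> bool" where
  "conformal_ifs Y V D \<phi> \<longleftrightarrow>
     compact Y \<and> ifs_on Y D \<phi> \<and>
     (\<forall>i\<in>D. open (V i) \<and> connected (V i) \<and> Y \<subseteq> V i \<and>
        inj_on (\<phi> i) (V i) \<and> contraction_on (V i) (\<phi> i) \<and>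
        (\<exists>\<phi>'. conformal_on (V i) (\<phi> i) \<phi>' \<and>
           0 < (INF x\<in>V i. norm (\<phi>' x)) \<and>
           (SUP x\<in>V i. norm (\<phi>' x)) < 1 \<and>
           (\<exists>\<alpha> c. 0 < \<alpha> \<and> 0 < c \<and>
              (\<forall>x\<in>V i. \<forall>y\<in>V i. \<bar>norm (\<phi>' x) - norm (\<phi>' y)\<bar> \<le> c * norm (x - y) powr \<alpha>))))"

text \<open>The open set must lie in the domains \<open>V i\<close>, since \<open>\<phi> i\<close> has no meaning elsewhere.\<close>

definition open_set_condition ::
  "('i \<Rightarrow> 'a::topological_space set) \<Rightarrow> 'i set \<Rightarrow> ('i \<Rightarrow> 'a \<Rightarrow> 'a) \<Rightarrow> bool" where
  "open_set_condition V D \<phi> \<longleftrightarrow>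
     (\<exists>U. open U \<and> U \<noteq> {} \<and> (\<forall>i\<in>D. U \<subseteq> V i \<and> \<phi> i ` U \<subseteq> U) \<and>
        (\<forall>i\<in>D. \<forall>j\<in>D. i \<noteq> j \<longrightarrow> \<phi> i ` U \<inter> \<phi> j ` U = {}))"

definition height_function :: "'a set \<Rightarrow> ('a \<Rightarrow> real) \<Rightarrow> bool" where
  "height_function E H \<longleftrightarrow> (\<forall>x\<in>E. 0 < H x)"

definition ifs_respects ::
  "'i set \<Rightarrow> ('i \<Rightarrow> 'a \<Rightarrow> 'a) \<Rightarrow> 'a set \<Rightarrow> ('a \<Rightarrow> real) \<Rightarrow> bool" where
  "ifs_respects D \<phi> E H \<longleftrightarrow>
     (\<forall>x\<in>E. \<forall>i\<in>D. \<phi> i x \<in> E) \<and>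
     (\<exists>C>1. \<forall>x\<in>E. \<forall>i\<in>D. H (\<phi> i x) < C * H x)"

text \<open>Hausdorff measure and dimension. Covering sets are required to be bounded because
  \<open>diameter\<close> is unspecified on unbounded sets. Only exponents \<open>s > 0\<close> are used in the dimension,
  which does not change the infimum and avoids \<open>0 powr 0 = 0\<close>.\<close>

definition hausdorff_premeasure :: "real \<Rightarrow> real \<Rightarrow> 'a::metric_space set \<Rightarrow> ennreal" where
  "hausdorff_premeasure s \<delta> A =
     (INF U\<in>{U :: nat \<Rightarrow> 'a set.
         A \<subseteq> (\<Union>n. U n) \<and> (\<forall>n. bounded (U n) \<and> diameter (U n) \<le> \<delta>)}.
        \<Sum>n. ennreal (diameter (U n) powr s))"

definition hausdorff_measure :: "real \<Rightarrow> 'a::metric_space set \<Rightarrow> ennreal" where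
  "hausdorff_measure s A = (SUP \<delta>\<in>{0<..}. hausdorff_premeasure s \<delta> A)"

definition hausdorff_dim :: "'a::metric_space set \<Rightarrow> ennreal" where
  "hausdorff_dim A = (INF s\<in>{s. 0 < s \<and> hausdorff_measure s A = 0}. ennreal s)"

end

theory Submission
  imports Defs
begin

text \<open>Fix a point \<open>e0\<close> of \<open>E\<close> in the attractor \<open>X\<close>. Its image \<open>e\<close> under a word \<open>w\<close> of length \<open>n\<close> lies in
  \<open>E\<close>, and its height is at most \<open>C ^ n * H e0\<close>. Hence a point is well approximated by \<open>e\<close> as soon as it
  lies within \<open>c0 * \<kappa> ^ n\<close> of it, where \<open>\<kappa> = C powr (- l) < 1\<close>. The maps contract, so this is achieved
  by prescribing the \<open>A * n + B\<close> letters that follow \<open>w\<close> in a code of the point to be the first letters of a code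
  of \<open>e0\<close>. The prescribed block is only proportional to \<open>n\<close>. If such blocks are inserted infinitely often but
  very sparsely, a positive proportion of all letters remains free
  (\<open>coded_word_padded_infinitely_often\<close>).

  The free letters are used to write down the binary digits of a parameter \<open>t\<close> in the unit interval, by means of
  two words \<open>u\<close> and \<open>v\<close> whose cylinders are disjoint. The maps are bi-Lipschitz on \<open>X\<close>, so the resulting points
  \<open>x t\<close> determine \<open>t\<close> in a Hoelder way (\<open>well_approximable_Hoelder_family\<close>). A set which is
  parametrised like this by almost all of the unit interval has positive dimension
  (\<open>hausdorff_dim_ge_inverse_Hoelder\<close>). Countably many parameters are discarded, namely those for which \<open>x t\<close>
  is itself an image of \<open>e0\<close>; for the others the approximating points of \<open>E\<close> are infinitely many.

  The words \<open>u\<close> and \<open>v\<close> exist unless \<open>X\<close> is a single point, which is then fixed by all the maps. This is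
  where the open set condition enters (\<open>conformal_ifs_no_common_fixed_point\<close>): near a common fixed point \<open>p\<close>,
  the maps \<open>\<phi> i \<circ> \<phi> j\<close> and \<open>\<phi> j \<circ> \<phi> i\<close> are almost similarities of equal ratio, and a volume count shows that
  their images of an open set cannot be disjoint subsets of it.\<close>

section \<open>Lower bounds for the Hausdorff dimension\<close>

text \<open>If \<open>x\<close> has an inverse that is Hoelder of exponent \<open>s\<close>, then a covering set of diameter \<open>\<delta>\<close>
  only contains points with parameters in an interval of length at most a constant times \<open>\<delta> powr s\<close>. These
  intervals must cover a set of Lebesgue measure one.\<close>

lemma hausdorff_dim_ge_inverse_Hoelder:
  fixes x :: "real \<Rightarrow> 'a::metric_space"
  assumes N: "countable N" and sub: "x ` ({0..<1} - N) \<subseteq> A"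
    and s: "0 < s" and K: "0 < K"
    and hoelder: "\<And>t t'. t \<in> {0..<1} \<Longrightarrow> t' \<in> {0..<1} \<Longrightarrow> \<bar>t - t'\<bar> \<le> K * dist (x t) (x t') powr s"
  shows "ennreal s \<le> hausdorff_dim A"
proof -
  let ?T = "{0..<1::real} - N"
  have T_measure: "emeasure lborel ?T = 1"
  proof -
    have "emeasure lborel (N \<inter> {0..<1}) = 0"
      using N by (intro emeasure_lborel_countable) auto
    moreover have "N \<inter> {0..<1} \<in> sets lborel"
      using N by (simp add: sets.countable countable_subset)
    ultimately have "emeasure lborel ({0..<1} - N \<inter> {0..<1}) = emeasure lborel {0..<1::real}"
      by (intro emeasure_Diff_null_set) auto
    then show ?thesis by (simp add: Diff_Int_distrib Diff_Int)
  qed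
  have "s \<le> s'" if s': "0 < s'" and null: "hausdorff_measure s' A = 0" for s'
  proof (rule ccontr)
    assume "\<not> s \<le> s'"
    (* For diameters at most 1 the power s' dominates the power s. *)
    then have less: "s' \<le> s" by simp
    have "ennreal (1 / (2 * K)) \<le> (\<Sum>n. ennreal (diameter (U n) powr s'))"
      if cover: "A \<subseteq> (\<Union>n. U n)" and small: "\<And>n. bounded (U n) \<and> diameter (U n) \<le> 1"
      for U :: "nat \<Rightarrow> 'a set"
    proof -
      define L where "L n = K * diameter (U n) powr s'" for n
      have L0: "0 \<le> L n" for n using K by (simp add: L_def)
      have close: "\<bar>t - t'\<bar> \<le> L n" if "t \<in> ?T" "t' \<in> ?T" "x t \<in> U n" "x t' \<in> U n" for t t' n
      proof -
        have d: "dist (x t) (x t') \<le> diameter (U n)"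
          using small that by (intro diameter_bounded_bound) auto
        have "\<bar>t - t'\<bar> \<le> K * dist (x t) (x t') powr s" using hoelder that by auto
        also have "\<dots> \<le> K * diameter (U n) powr s"
          using K s d by (intro mult_left_mono powr_mono2) auto
        also have "\<dots> \<le> L n"
          unfolding L_def using K less small s d
          by (intro mult_left_mono powr_mono') (auto intro: order_trans[OF zero_le_dist])
        finally show ?thesis .
      qed
      have "\<exists>c. \<forall>t\<in>?T. x t \<in> U n \<longrightarrow> t \<in> {c - L n .. c + L n}" for n
      proof (cases "\<exists>t\<in>?T. x t \<in> U n")
        case True
        then obtain c where "c \<in> ?T" "x c \<in> U n" by blast
        then show ?thesis using close[of _ c n] by (intro exI[of _ c]) fastforce
      qed auto
      then obtain c where c: "\<And>n t. t \<in> ?T \<Longrightarrow> x t \<in> U n \<Longrightarrow> t \<in> {c n - L n .. c n + L n}"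
        by metis
      have "?T \<subseteq> (\<Union>n. {c n - L n .. c n + L n})"
      proof
        fix t assume t: "t \<in> ?T"
        then obtain n where "x t \<in> U n" using sub cover by blast
        then show "t \<in> (\<Union>n. {c n - L n .. c n + L n})" using c[OF t] by blast
      qed
      then have "1 \<le> emeasure lborel (\<Union>n. {c n - L n .. c n + L n})"
        using emeasure_mono[of ?T "\<Union>n. {c n - L n .. c n + L n}" lborel] T_measure by simp
      also have "\<dots> \<le> (\<Sum>n. emeasure lborel {c n - L n .. c n + L n})"
        by (intro emeasure_subadditive_countably) auto
      also have "\<dots> = (\<Sum>n. ennreal (2 * K) * ennreal (diameter (U n) powr s'))"
      proof (intro suminf_cong)
        fix n show "emeasure lborel {c n - L n .. c n + L n} = ennreal (2 * K) * ennreal (diameter (U n) powr s')"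
          using L0[of n] K by (simp add: L_def flip: ennreal_mult)
      qed
      also have "\<dots> = ennreal (2 * K) * (\<Sum>n. ennreal (diameter (U n) powr s'))"
        by simp
      finally have "ennreal (1 / (2 * K)) * 1 \<le> ennreal (1 / (2 * K)) * (ennreal (2 * K) * (\<Sum>n. ennreal (diameter (U n) powr s')))"
        by (rule mult_left_mono) simp
      then show ?thesis
        using K by (simp add: mult.assoc[symmetric] ennreal_mult[symmetric])
    qed
    then have "ennreal (1 / (2 * K)) \<le> hausdorff_premeasure s' 1 A"
      unfolding hausdorff_premeasure_def by (intro INF_greatest) auto
    also have "\<dots> \<le> hausdorff_measure s' A"
      unfolding hausdorff_measure_def by (intro SUP_upper) auto
    finally show False using null K by (simp add: ennreal_eq_0_iff)
  qed
  then show ?thesis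
    unfolding hausdorff_dim_def by (intro INF_greatest ennreal_leI) auto
qed

section \<open>Conformal maps are locally and globally bi-Lipschitz\<close>

text \<open>The differential at \<open>p\<close> is a similarity of ratio \<open>norm (f' p)\<close>, and by continuity of the derivative \<open>f\<close>
  differs from it near \<open>p\<close> by a map with arbitrarily small Lipschitz constant.\<close>

lemma conformal_nearly_similar:
  assumes conf: "conformal_on V f f'" and V: "open V" "p \<in> V" and e: "0 < e"
  obtains \<rho> where "0 < \<rho>" "ball p \<rho> \<subseteq> V"
    "\<And>x y. x \<in> ball p \<rho> \<Longrightarrow> y \<in> ball p \<rho> \<Longrightarrow> (norm (f' p) - e) * dist x y \<le> dist (f x) (f y)"
    "\<And>x y. x \<in> ball p \<rho> \<Longrightarrow> y \<in> ball p \<rho> \<Longrightarrow> dist (f x) (f y) \<le> (norm (f' p) + e) * dist x y"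
proof -
  have "continuous_on V f'" using conf by (simp add: conformal_on_def)
  then obtain d where d: "0 < d" "\<And>x. x \<in> V \<Longrightarrow> dist x p < d \<Longrightarrow> dist (f' x) (f' p) < e"
    using V(2) e by (meson continuous_on_iff)
  obtain d' where d': "0 < d'" "ball p d' \<subseteq> V" using V by (meson openE)
  define \<rho> where "\<rho> = min d d'"
  have sub: "ball p \<rho> \<subseteq> V" using d' by (auto simp: \<rho>_def)
  (* The remainder of f after subtracting its differential at p has derivative of norm
     below e near p, hence is e-Lipschitz there. *)
  have rem: "norm ((f x - f' p x) - (f y - f' p y)) \<le> e * norm (x - y)"
    if "x \<in> ball p \<rho>" "y \<in> ball p \<rho>" for x y
  proof (rule differentiable_bound[where f = "\<lambda>x. f x - f' p x" and f' = "\<lambda>z. blinfun_apply (f' z - f' p)" and S = "ball p \<rho>"])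
    fix z assume z: "z \<in> ball p \<rho>"
    then have "z \<in> V" using sub by blast
    then have "(f has_derivative blinfun_apply (f' z)) (at z within ball p \<rho>)"
      using conf unfolding conformal_on_def by (blast intro: has_derivative_at_withinI)
    then have "((\<lambda>x. f x - f' p x) has_derivative (\<lambda>h. f' z h - f' p h)) (at z within ball p \<rho>)"
      using bounded_linear_imp_has_derivative[OF blinfun.bounded_linear_right[of "f' p"]]
      by (rule has_derivative_diff)
    moreover have "(\<lambda>h. f' z h - f' p h) = blinfun_apply (f' z - f' p)"
      by (rule ext) (rule blinfun.diff_left[symmetric])
    ultimately show "((\<lambda>x. f x - f' p x) has_derivative blinfun_apply (f' z - f' p)) (at z within ball p \<rho>)"
      by (rule subst[rotated])
    have "norm (f' z - f' p) < e"
      using d(2)[OF \<open>z \<in> V\<close>] z by (simp add: dist_norm[symmetric] \<rho>_def dist_commute)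
    then show "onorm (blinfun_apply (f' z - f' p)) \<le> e"
      by (simp add: norm_blinfun.rep_eq)
  qed (use that in auto)
  have lin: "norm (f' p x - f' p y) = norm (f' p) * norm (x - y)" for x y
    using conf V by (simp add: conformal_on_def flip: blinfun.diff_right)
  show thesis
  proof
    show "0 < \<rho>" using d d' by (simp add: \<rho>_def)
    fix x y assume xy: "x \<in> ball p \<rho>" "y \<in> ball p \<rho>"
    have *: "(f x - f y) - (f' p x - f' p y) = (f x - f' p x) - (f y - f' p y)" by simp
    have "norm (f' p) * norm (x - y) - norm (f x - f y) \<le> e * norm (x - y)"
      "norm (f x - f y) - norm (f' p) * norm (x - y) \<le> e * norm (x - y)"
      using rem[OF xy] norm_triangle_ineq3[of "f x - f y" "f' p x - f' p y"] lin[of x y] * by auto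
    then show "(norm (f' p) - e) * dist x y \<le> dist (f x) (f y)"
      "dist (f x) (f y) \<le> (norm (f' p) + e) * dist x y"
      by (simp_all add: dist_norm algebra_simps)
  qed (fact sub)
qed

text \<open>Failure of a uniform lower bound would produce two sequences in \<open>X\<close> with colliding images.
  Their limits have equal images, so they coincide by injectivity, and there the local estimate is
  contradicted.\<close>

lemma conformal_lower_Lipschitz_on_compact:
  assumes conf: "conformal_on V f f'" and V: "open V" "compact X" "X \<subseteq> V" and inj: "inj_on f V"
    and pos: "\<And>x. x \<in> V \<Longrightarrow> 0 < norm (f' x)"
  shows "\<exists>c>0. \<forall>x\<in>X. \<forall>y\<in>X. c * dist x y \<le> dist (f x) (f y)"
proof (rule ccontr)
  assume contra: "\<not> ?thesis"
  then have "\<exists>z. z \<in> X \<times> X \<and> dist (f (fst z)) (f (snd z)) < 1 / Suc n * dist (fst z) (snd z)" for n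
  proof -
    have "(0::real) < 1 / Suc n" by simp
    then obtain x y where "x \<in> X" "y \<in> X" "\<not> 1 / Suc n * dist x y \<le> dist (f x) (f y)"
      using contra by blast
    then show ?thesis by (intro exI[of _ "(x, y)"]) auto
  qed
  then obtain z where z: "\<And>n. z n \<in> X \<times> X"
    "\<And>n. dist (f (fst (z n))) (f (snd (z n))) < 1 / Suc n * dist (fst (z n)) (snd (z n))"
    by metis
  have "seq_compact (X \<times> X)" using V(2) by (simp add: compact_Times compact_imp_seq_compact)
  then obtain w h where w: "w \<in> X \<times> X" and h: "strict_mono h" "(z \<circ> h) \<longlonglongrightarrow> w"
    using z(1) unfolding seq_compact_def by blast
  have lim: "(\<lambda>n. fst (z (h n))) \<longlonglongrightarrow> fst w" "(\<lambda>n. snd (z (h n))) \<longlonglongrightarrow> snd w"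
    using tendsto_fst[OF h(2)] tendsto_snd[OF h(2)] by (simp_all add: o_def)
  have cont: "isCont f v" if "v \<in> X" for v
    using that conf V(3) by (auto simp: conformal_on_def intro: has_derivative_continuous)
  have flim: "(\<lambda>n. f (fst (z (h n)))) \<longlonglongrightarrow> f (fst w)" "(\<lambda>n. f (snd (z (h n)))) \<longlonglongrightarrow> f (snd w)"
    using w lim cont by (auto intro: isCont_tendsto_compose)
  have inv: "(\<lambda>n. 1 / real (Suc (h n))) \<longlonglongrightarrow> 0"
    using LIMSEQ_subseq_LIMSEQ[OF LIMSEQ_inverse_real_of_nat h(1)] by (simp add: o_def inverse_eq_divide)
  have "dist (f (fst w)) (f (snd w)) \<le> 0 * dist (fst w) (snd w)"
  proof (rule LIMSEQ_le)
    show "(\<lambda>n. dist (f (fst (z (h n)))) (f (snd (z (h n))))) \<longlonglongrightarrow> dist (f (fst w)) (f (snd w))"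
      using flim by (rule tendsto_dist)
    show "(\<lambda>n. 1 / real (Suc (h n)) * dist (fst (z (h n))) (snd (z (h n)))) \<longlonglongrightarrow> 0 * dist (fst w) (snd w)"
      by (intro tendsto_mult inv tendsto_dist lim)
    show "\<exists>N. \<forall>n\<ge>N. dist (f (fst (z (h n)))) (f (snd (z (h n)))) \<le> 1 / real (Suc (h n)) * dist (fst (z (h n))) (snd (z (h n)))"
      using z(2) less_imp_le by blast
  qed
  then have "f (snd w) = f (fst w)" by simp
  then have eq: "snd w = fst w" using inj_onD[OF inj] w V(3) by (metis mem_Times_iff subsetD)
  define p where "p = fst w"
  have p: "p \<in> V" using w V(3) by (auto simp: p_def)
  obtain \<rho> where \<rho>: "0 < \<rho>" "\<And>x y. x \<in> ball p \<rho> \<Longrightarrow> y \<in> ball p \<rho> \<Longrightarrow>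
      (norm (f' p) - norm (f' p) / 2) * dist x y \<le> dist (f x) (f y)"
    by (rule conformal_nearly_similar[OF conf V(1) p, of "norm (f' p) / 2"]) (use pos[OF p] in auto)
  have "\<forall>\<^sub>F n in sequentially. dist (fst (z (h n))) p < \<rho>"
    "\<forall>\<^sub>F n in sequentially. dist (snd (z (h n))) p < \<rho>"
    "\<forall>\<^sub>F n in sequentially. 1 / real (Suc (h n)) < norm (f' p) / 2"
    using lim eq \<rho>(1) pos[OF p] order_tendstoD(2)[OF inv, of "norm (f' p) / 2"]
    by (auto simp: p_def dest: tendstoD)
  then have "\<forall>\<^sub>F n in sequentially. False"
  proof eventually_elim
    case (elim n)
    let ?x = "fst (z (h n))" and ?y = "snd (z (h n))"
    have "norm (f' p) / 2 * dist ?x ?y \<le> dist (f ?x) (f ?y)"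
      using \<rho>(2)[of ?x ?y] elim by (simp add: dist_commute)
    also have "\<dots> < 1 / Suc (h n) * dist ?x ?y" by (rule z(2))
    also have "\<dots> \<le> norm (f' p) / 2 * dist ?x ?y"
      using elim by (intro mult_right_mono) auto
    finally show ?case by simp
  qed
  then show False by simp
qed

lemma conformal_ifs_map:
  assumes "conformal_ifs Y V D \<phi>" "i \<in> D"
  shows "open (V i)" "Y \<subseteq> V i" "inj_on (\<phi> i) (V i)" "contraction_on (V i) (\<phi> i)"
    "\<exists>f'. conformal_on (V i) (\<phi> i) f' \<and> (\<forall>x\<in>V i. 0 < norm (f' x))"
proof -
  show "open (V i)" "Y \<subseteq> V i" "inj_on (\<phi> i) (V i)" "contraction_on (V i) (\<phi> i)"
    using assms unfolding conformal_ifs_def by auto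
  have "\<exists>f'. conformal_on (V i) (\<phi> i) f' \<and> 0 < (INF x\<in>V i. norm (f' x))"
    using assms unfolding conformal_ifs_def by auto
  then obtain f' where conf: "conformal_on (V i) (\<phi> i) f'" and pos: "0 < (INF x\<in>V i. norm (f' x))"
    by (elim exE conjE)
  have "0 < norm (f' x)" if "x \<in> V i" for x
  proof -
    have "(INF x\<in>V i. norm (f' x)) \<le> norm (f' x)"
      using that by (intro cINF_lower) (auto intro: bdd_belowI2[of _ 0])
    with pos show ?thesis by (rule less_le_trans)
  qed
  then show "\<exists>f'. conformal_on (V i) (\<phi> i) f' \<and> (\<forall>x\<in>V i. 0 < norm (f' x))"
    using conf by blast
qed

section \<open>The open set condition excludes a common fixed point\<close>

text \<open>By invariance of domain the image of a ball is open, and the lower Lipschitz bound keeps its boundary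
  at distance \<open>a * s\<close> from the image of the centre. Slightly smaller balls are used because \<open>f\<close> need not be
  controlled on the closure of \<open>ball z s\<close>.\<close>

lemma expanding_image_contains_ball:
  fixes f :: "'a::euclidean_space \<Rightarrow> 'a"
  assumes cont: "continuous_on W f" and sub: "ball z s \<subseteq> W" and a: "0 < a"
    and low: "\<And>x y. x \<in> W \<Longrightarrow> y \<in> W \<Longrightarrow> a * dist x y \<le> dist (f x) (f y)"
  shows "ball (f z) (a * s) \<subseteq> f ` ball z s"
proof
  fix y assume y: "y \<in> ball (f z) (a * s)"
  have "dist (f z) y / a < s" using y a by (simp add: field_simps)
  moreover have "0 \<le> dist (f z) y / a" using a by simp
  ultimately obtain t where t: "0 < t" "t < s" "dist (f z) y / a < t"
    by (metis dense order_le_less_trans)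
  have ts: "cball z t \<subseteq> W" using sub t by auto
  have inj: "inj_on f W"
  proof (rule inj_onI)
    fix x y assume "x \<in> W" "y \<in> W" "f x = f y"
    then have "a * dist x y \<le> 0" using low[of x y] by simp
    then show "x = y" using a by (simp add: mult_le_0_iff)
  qed
  have "ball (f z) (a * t) \<subseteq> f ` ball z t"
  proof (rule ball_subset_open_map_image)
    show "continuous_on (closure (ball z t)) f"
      using cont ts t by (auto intro: continuous_on_subset)
    show "open (f ` interior (ball z t))"
    proof -
      have "ball z t \<subseteq> W" using ts by auto
      then show ?thesis
        using continuous_on_subset[OF cont] inj_on_subset[OF inj] by (simp add: invariance_of_domain)
    qed
    show "a * t \<le> norm (f x - f z)" if "x \<in> frontier (ball z t)" for x
    proof -
      have "dist x z = t" using that t by (simp add: dist_commute)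
      moreover have "x \<in> W" "z \<in> W" using ts t \<open>dist x z = t\<close> by (auto simp: dist_commute subset_iff)
      ultimately show ?thesis using low[of x z] by (simp add: dist_norm)
    qed
  qed (use t a in auto)
  moreover have "y \<in> ball (f z) (a * t)" using t a by (simp add: field_simps)
  ultimately show "y \<in> f ` ball z s" using t by auto
qed

text \<open>Starting from one ball in \<open>W\<close>, the \<open>2 ^ n\<close> compositions of length \<open>n\<close> produce as many disjoint
  balls of radius proportional to \<open>a ^ n\<close> inside a ball of radius proportional to \<open>b ^ n\<close>. In
  dimension \<open>d\<close> the volumes give \<open>(2 * a ^ d) ^ n\<close> at most a constant times \<open>(b ^ d) ^ n\<close>, which is absurd for large
  \<open>n\<close>.\<close>

lemma no_two_disjoint_near_similarities:
  fixes g :: "bool \<Rightarrow> 'a::euclidean_space \<Rightarrow> 'a"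
  assumes W: "open W" "W \<noteq> {}" "bounded W"
    and cont: "\<And>i. continuous_on W (g i)" and inv: "\<And>i. g i ` W \<subseteq> W"
    and disj: "g True ` W \<inter> g False ` W = {}"
    and ab: "0 < a" "0 < b" "(b / a) ^ DIM('a) < 2"
    and low: "\<And>i x y. x \<in> W \<Longrightarrow> y \<in> W \<Longrightarrow> a * dist x y \<le> dist (g i x) (g i y)"
    and up: "\<And>i x. x \<in> W \<Longrightarrow> dist p (g i x) \<le> b * dist p x"
  shows False
proof -
  obtain z0 \<rho> where \<rho>: "0 < \<rho>" "ball z0 \<rho> \<subseteq> W" using W by (meson ex_in_conv openE)
  obtain R where R: "0 < R" "W \<subseteq> cball p R"
    using bounded_subset_ballD[OF W(3), of p] ball_subset_cball by (meson order_trans)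
  have inj: "inj_on (g i) W" for i
  proof (rule inj_onI)
    fix x y assume "x \<in> W" "y \<in> W" "g i x = g i y"
    then have "a * dist x y \<le> 0" using low[of x y i] by simp
    then show "x = y" using ab by (simp add: mult_le_0_iff)
  qed
  let ?P = "\<lambda>n Z. finite Z \<and> card Z = 2 ^ n \<and>
    (\<forall>z\<in>Z. ball z (a ^ n * \<rho>) \<subseteq> W \<inter> cball p (b ^ n * R)) \<and>
    disjoint_family_on (\<lambda>z. ball z (a ^ n * \<rho>)) Z"
  have ex: "\<exists>Z. ?P n Z" for n
  proof (induction n)
    case 0
    show ?case using \<rho> R by (intro exI[of _ "{z0}"]) (auto simp: disjoint_family_on_def)
  next
    case (Suc n)
    then obtain Z where fin: "finite Z" and card: "card Z = 2 ^ n"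
      and sub: "\<And>z. z \<in> Z \<Longrightarrow> ball z (a ^ n * \<rho>) \<subseteq> W \<inter> cball p (b ^ n * R)"
      and dis: "disjoint_family_on (\<lambda>z. ball z (a ^ n * \<rho>)) Z" by blast
    let ?s = "a ^ n * \<rho>"
    have s: "0 < ?s" using ab \<rho> by simp
    have ZW: "Z \<subseteq> W" using sub s by (meson centre_in_ball inf.boundedE subset_iff)
    have img: "ball (g i z) (a ^ Suc n * \<rho>) \<subseteq> g i ` ball z ?s" if "z \<in> Z" for i z
      using expanding_image_contains_ball[OF cont _ ab(1) low, of z ?s i] sub[OF that]
      by (simp add: mult.assoc)
    define Z' where "Z' = g True ` Z \<union> g False ` Z"
    have Z'E: "\<exists>i. \<exists>y\<in>Z. z = g i y" if "z \<in> Z'" for z using that by (auto simp: Z'_def)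
    have "finite Z'" using fin by (simp add: Z'_def)
    moreover have "card Z' = 2 ^ Suc n"
    proof -
      have "g True ` Z \<inter> g False ` Z = {}" using disj ZW by blast
      then have "card Z' = card (g True ` Z) + card (g False ` Z)"
        using fin by (simp add: Z'_def card_Un_disjoint)
      then show ?thesis using card inj_on_subset[OF inj ZW] by (simp add: card_image)
    qed
    moreover have "ball z (a ^ Suc n * \<rho>) \<subseteq> W \<inter> cball p (b ^ Suc n * R)" if zZ: "z \<in> Z'" for z
    proof
      fix y assume y: "y \<in> ball z (a ^ Suc n * \<rho>)"
      obtain i z1 where z1: "z1 \<in> Z" "z = g i z1" using Z'E zZ by blast
      then obtain v where v: "v \<in> ball z1 ?s" "y = g i v" using img[OF z1(1), of i] y by blast
      then have vW: "v \<in> W" "dist p v \<le> b ^ n * R" using sub[OF z1(1)] by auto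
      have "dist p y \<le> b * dist p v" using up[OF vW(1), of i] v(2) by simp
      also have "\<dots> \<le> b * (b ^ n * R)" using vW(2) ab(2) by (intro mult_left_mono) auto
      finally have "dist p y \<le> b * (b ^ n * R)" .
      then show "y \<in> W \<inter> cball p (b ^ Suc n * R)"
        using inv vW v(2) by (auto simp: mult.assoc)
    qed
    moreover have "disjoint_family_on (\<lambda>z. ball z (a ^ Suc n * \<rho>)) Z'"
      unfolding disjoint_family_on_def
    proof (intro ballI impI)
      fix z z' assume zz: "z \<in> Z'" "z' \<in> Z'" "z \<noteq> z'"
      from zz(1) obtain i z1 where z1: "z1 \<in> Z" "z = g i z1" using Z'E by blast
      from zz(2) obtain j z2 where z2: "z2 \<in> Z" "z' = g j z2" using Z'E by blast
      have "g i ` ball z1 ?s \<inter> g j ` ball z2 ?s = {}"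
      proof (cases "i = j")
        case True
        then have "z1 \<noteq> z2" using zz z1 z2 by auto
        then have "ball z1 ?s \<inter> ball z2 ?s = {}"
          using dis z1 z2 by (auto simp: disjoint_family_on_def)
        then show ?thesis
          using True inj_on_image_Int[OF inj[of j], of "ball z1 ?s" "ball z2 ?s"] sub z1 z2 by auto
      next
        case False
        then have "g i ` W \<inter> g j ` W = {}" using disj by (cases i; cases j) auto
        then show ?thesis using sub[OF z1(1)] sub[OF z2(1)] by blast
      qed
      then show "ball z (a ^ Suc n * \<rho>) \<inter> ball z' (a ^ Suc n * \<rho>) = {}"
        using img[OF z1(1), of i] img[OF z2(1), of j] z1 z2 by blast
    qed
    ultimately show ?case by blast
  qed
  let ?d = "DIM('a)"
  define q where "q = 2 / (b / a) ^ ?d"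
  have bound: "q ^ n \<le> (R / \<rho>) ^ ?d" for n
  proof -
    obtain Z where fin: "finite Z" and card: "card Z = 2 ^ n"
      and sub: "\<And>z. z \<in> Z \<Longrightarrow> ball z (a ^ n * \<rho>) \<subseteq> W \<inter> cball p (b ^ n * R)"
      and dis: "disjoint_family_on (\<lambda>z. ball z (a ^ n * \<rho>)) Z" using ex[of n] by blast
    let ?v = "unit_ball_vol (real ?d)"
    have "2 ^ n * (?v * (a ^ n * \<rho>) ^ ?d) = (\<Sum>z\<in>Z. measure lborel (ball z (a ^ n * \<rho>)))"
      using card ab \<rho> by (simp add: content_ball)
    also have "\<dots> = measure lborel (\<Union>z\<in>Z. ball z (a ^ n * \<rho>))"
      using fin dis emeasure_lborel_ball_finite
      by (intro measure_finite_Union[symmetric]) (auto simp: less_top)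
    also have "\<dots> \<le> measure lborel (cball p (b ^ n * R))"
    proof (rule measure_mono_fmeasurable)
      show "(\<Union>z\<in>Z. ball z (a ^ n * \<rho>)) \<subseteq> cball p (b ^ n * R)" using sub by blast
      show "(\<Union>z\<in>Z. ball z (a ^ n * \<rho>)) \<in> sets lborel" by (auto intro: borel_open)
      show "cball p (b ^ n * R) \<in> fmeasurable lborel" by (simp add: fmeasurable_compact)
    qed
    also have "\<dots> = ?v * (b ^ n * R) ^ ?d"
      using ab R by (simp add: content_cball)
    finally have "2 ^ n * (a ^ n * \<rho>) ^ ?d \<le> (b ^ n * R) ^ ?d"
      using unit_ball_vol_pos[of "real ?d"] by (simp add: mult.left_commute)
    then show ?thesis
      using ab R \<rho> by (simp add: q_def field_simps power_mult_distrib flip: power_mult)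
  qed
  have "1 < q" using ab by (simp add: q_def field_simps)
  then obtain n where "(R / \<rho>) ^ ?d < q ^ n" using real_arch_pow by blast
  with bound[of n] show False by simp
qed

text \<open>The two compositions \<open>\<phi> i \<circ> \<phi> j\<close> and \<open>\<phi> j \<circ> \<phi> i\<close> have differentials of the same norm at a common
  fixed point \<open>p\<close>. Near \<open>p\<close> both are therefore almost similarities with the same ratio, while the
  open set condition makes their images disjoint.\<close>

lemma conformal_ifs_no_common_fixed_point:
  fixes \<phi> :: "'i \<Rightarrow> 'a::euclidean_space \<Rightarrow> 'a"
  assumes ifs: "conformal_ifs Y V D \<phi>" and osc: "open_set_condition V D \<phi>"
    and ij: "i \<in> D" "j \<in> D" "i \<noteq> j" and p: "p \<in> Y" "\<phi> i p = p" "\<phi> j p = p"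
  shows False
proof -
  obtain U where U_osc: "open U" "U \<noteq> {}" "\<forall>k\<in>D. U \<subseteq> V k \<and> \<phi> k ` U \<subseteq> U"
    "\<forall>i\<in>D. \<forall>j\<in>D. i \<noteq> j \<longrightarrow> \<phi> i ` U \<inter> \<phi> j ` U = {}"
    using osc unfolding open_set_condition_def by (elim exE conjE)
  then have U: "open U" "U \<noteq> {}" "\<And>k. k \<in> D \<Longrightarrow> U \<subseteq> V k" "\<And>k. k \<in> D \<Longrightarrow> \<phi> k ` U \<subseteq> U"
    "\<phi> i ` U \<inter> \<phi> j ` U = {}"
    using ij by simp_all
  (* Ratios are controlled up to factors 1 - \<theta> and 1 + \<theta>; the exponent 2 comes from composing two maps. *)
  have "((\<lambda>\<theta>::real. (((1 + \<theta>) / (1 - \<theta>)) ^ 2) ^ DIM('a)) \<longlongrightarrow> (((1 + 0) / (1 - 0)) ^ 2) ^ DIM('a)) (at_right 0)"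
    by (intro tendsto_intros) auto
  then have "\<forall>\<^sub>F \<theta> in at_right (0::real). (((1 + \<theta>) / (1 - \<theta>)) ^ 2) ^ DIM('a) < 2"
    by (rule order_tendstoD) simp
  moreover have "\<forall>\<^sub>F \<theta> in at_right (0::real). 0 < \<theta> \<and> \<theta> < 1"
    using eventually_at_right_real[of 0 1] by (simp add: greaterThanLessThan_iff)
  ultimately have "\<forall>\<^sub>F \<theta> in at_right (0::real). 0 < \<theta> \<and> \<theta> < 1 \<and> (((1 + \<theta>) / (1 - \<theta>)) ^ 2) ^ DIM('a) < 2"
    by eventually_elim auto
  then obtain \<theta> :: real where \<theta>: "0 < \<theta>" "\<theta> < 1" "(((1 + \<theta>) / (1 - \<theta>)) ^ 2) ^ DIM('a) < 2"
    using eventually_happens by force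
  define near_similar where "near_similar k m s \<longleftrightarrow> 0 < m \<and> 0 < s \<and>
      (\<forall>x\<in>ball p s. \<forall>y\<in>ball p s. m * (1 - \<theta>) * dist x y \<le> dist (\<phi> k x) (\<phi> k y) \<and>
        dist (\<phi> k x) (\<phi> k y) \<le> m * (1 + \<theta>) * dist x y)" for k m s
  have "\<exists>\<mu> \<rho>. near_similar k \<mu> \<rho>"
    if k: "k \<in> D" for k
  proof -
    obtain f' where V: "open (V k)" "p \<in> V k" and conf: "conformal_on (V k) (\<phi> k) f'"
      and l: "0 < norm (f' p)"
      using conformal_ifs_map[OF ifs k] p(1) by blast
    have e: "0 < norm (f' p) * \<theta>" using \<theta> l by simp
    show ?thesis
    proof (rule conformal_nearly_similar[OF conf V e])
      fix \<rho> :: real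
      assume "0 < \<rho>"
        "\<And>x y. x \<in> ball p \<rho> \<Longrightarrow> y \<in> ball p \<rho> \<Longrightarrow> (norm (f' p) - norm (f' p) * \<theta>) * dist x y \<le> dist (\<phi> k x) (\<phi> k y)"
        "\<And>x y. x \<in> ball p \<rho> \<Longrightarrow> y \<in> ball p \<rho> \<Longrightarrow> dist (\<phi> k x) (\<phi> k y) \<le> (norm (f' p) + norm (f' p) * \<theta>) * dist x y"
      then have "near_similar k (norm (f' p)) \<rho>"
        using l by (simp add: near_similar_def distrib_left right_diff_distrib)
      then show ?thesis by blast
    qed
  qed
  then have "\<forall>k\<in>D. \<exists>\<mu>. \<exists>\<rho>. near_similar k \<mu> \<rho>" by blast
  then obtain \<mu> where "\<forall>k\<in>D. \<exists>\<rho>. near_similar k (\<mu> k) \<rho>" by (rule bchoice[THEN exE])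
  then obtain \<rho> where "\<forall>k\<in>D. near_similar k (\<mu> k) (\<rho> k)" by (rule bchoice[THEN exE])
  then have loc: "\<And>k. k \<in> D \<Longrightarrow> 0 < \<mu> k" "\<And>k. k \<in> D \<Longrightarrow> 0 < \<rho> k"
    "\<And>k x y. k \<in> D \<Longrightarrow> x \<in> ball p (\<rho> k) \<Longrightarrow> y \<in> ball p (\<rho> k) \<Longrightarrow> \<mu> k * (1 - \<theta>) * dist x y \<le> dist (\<phi> k x) (\<phi> k y)"
    "\<And>k x y. k \<in> D \<Longrightarrow> x \<in> ball p (\<rho> k) \<Longrightarrow> y \<in> ball p (\<rho> k) \<Longrightarrow> dist (\<phi> k x) (\<phi> k y) \<le> \<mu> k * (1 + \<theta>) * dist x y"
    unfolding near_similar_def by blast+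
  define \<sigma> where "\<sigma> = min (\<rho> i) (\<rho> j)"
  define W where "W = U \<inter> ball p \<sigma>"
  have contr: "\<exists>r. 0 < r \<and> r < 1 \<and> (\<forall>x\<in>V k. dist p (\<phi> k x) \<le> r * dist p x)" if "k \<in> {i, j}" for k
  proof -
    have "contraction_on (V k) (\<phi> k)" "p \<in> V k" "\<phi> k p = p"
      using ifs that ij p unfolding conformal_ifs_def by auto
    then show ?thesis unfolding contraction_on_def by metis
  qed
  have W_inv: "\<phi> k ` W \<subseteq> W" if k: "k \<in> {i, j}" for k
  proof
    fix y assume "y \<in> \<phi> k ` W"
    then obtain x where x: "x \<in> U" "x \<in> ball p \<sigma>" "y = \<phi> k x" by (auto simp: W_def)
    obtain r where r: "0 < r" "r < 1" "dist p y \<le> r * dist p x"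
      using contr[OF k] U(3)[of k] ij k x by blast
    have "r * dist p x \<le> 1 * dist p x" using r by (intro mult_right_mono) auto
    then show "y \<in> W" using r x U(4)[of k] ij k by (auto simp: W_def)
  qed
  have W_in: "\<phi> i x \<in> W" "\<phi> j x \<in> W" if "x \<in> W" for x
    using W_inv[of i] W_inv[of j] that by blast+
  (* Iterating \<phi> i moves any point of U towards p without leaving U. *)
  have "W \<noteq> {}"
  proof -
    obtain z where z: "z \<in> U" using U by blast
    obtain r where r: "0 < r" "r < 1" "\<And>x. x \<in> V i \<Longrightarrow> dist p (\<phi> i x) \<le> r * dist p x"
      using contr[of i] by blast
    have it: "(\<phi> i ^^ n) z \<in> U \<and> dist p ((\<phi> i ^^ n) z) \<le> r ^ n * dist p z" for n
    proof (induction n)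
      case (Suc n)
      then have "dist p (\<phi> i ((\<phi> i ^^ n) z)) \<le> r * dist p ((\<phi> i ^^ n) z)"
        using r(3) U(3) ij by blast
      also have "\<dots> \<le> r * (r ^ n * dist p z)" using Suc r by (intro mult_left_mono) auto
      finally show ?case using Suc U(4)[OF ij(1)] by (auto simp: mult.assoc)
    qed (use z in auto)
    have "(\<lambda>n. r ^ n * dist p z) \<longlonglongrightarrow> 0 * dist p z"
      using r by (intro tendsto_mult LIMSEQ_power_zero tendsto_const) auto
    moreover have "0 < \<sigma>" using loc ij by (simp add: \<sigma>_def)
    ultimately have "\<forall>\<^sub>F n in sequentially. r ^ n * dist p z < \<sigma>" by (auto dest: order_tendstoD)
    then obtain n where "r ^ n * dist p z < \<sigma>" using eventually_happens by force
    then have "(\<phi> i ^^ n) z \<in> W" using it[of n] by (auto simp: W_def)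
    then show ?thesis by blast
  qed
  have low: "\<mu> k * (1 - \<theta>) * dist x y \<le> dist (\<phi> k x) (\<phi> k y)"
    and up: "dist (\<phi> k x) (\<phi> k y) \<le> \<mu> k * (1 + \<theta>) * dist x y"
    if "k \<in> {i, j}" "x \<in> ball p \<sigma>" "y \<in> ball p \<sigma>" for k x y
    using that ij loc(3,4)[of k x y] by (auto simp: \<sigma>_def)
  define a where "a = \<mu> i * \<mu> j * (1 - \<theta>) ^ 2"
  define b where "b = \<mu> i * \<mu> j * (1 + \<theta>) ^ 2"
  define g where "g t = (if t then \<phi> i \<circ> \<phi> j else \<phi> j \<circ> \<phi> i)" for t
  have pos: "0 < \<mu> i" "0 < \<mu> j" "0 < a" "0 < b" using loc ij \<theta> by (auto simp: a_def b_def)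
  have p\<sigma>: "p \<in> ball p \<sigma>" using loc ij by (simp add: \<sigma>_def)
  have comp: "a * dist x y \<le> dist (\<phi> k (\<phi> m x)) (\<phi> k (\<phi> m y))"
    "dist (\<phi> k (\<phi> m x)) (\<phi> k (\<phi> m y)) \<le> b * dist x y"
    if km: "k = i \<and> m = j \<or> k = j \<and> m = i" and x: "x \<in> W" and y: "y = p \<or> y \<in> W" for k m x y
  proof -
    have k: "k \<in> {i, j}" and m: "m \<in> {i, j}" using km by auto
    have xy: "x \<in> ball p \<sigma>" "y \<in> ball p \<sigma>" using x y p\<sigma> by (auto simp: W_def)
    have fxy: "\<phi> m x \<in> ball p \<sigma>" "\<phi> m y \<in> ball p \<sigma>"
    proof -
      have stay: "\<phi> m z \<in> ball p \<sigma>" if "z \<in> W" for z using W_inv[OF m] that by (auto simp: W_def image_subset_iff)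
      then show "\<phi> m x \<in> ball p \<sigma>" using x by blast
      show "\<phi> m y \<in> ball p \<sigma>" using y stay m p p\<sigma> by (elim disjE) auto
    qed
    have ab: "a = \<mu> k * (1 - \<theta>) * (\<mu> m * (1 - \<theta>))" "b = \<mu> k * (1 + \<theta>) * (\<mu> m * (1 + \<theta>))"
      using km by (auto simp: a_def b_def power2_eq_square)
    have pk: "0 \<le> \<mu> k * (1 - \<theta>)" "0 \<le> \<mu> k * (1 + \<theta>)" using pos \<theta> k by auto
    show "a * dist x y \<le> dist (\<phi> k (\<phi> m x)) (\<phi> k (\<phi> m y))"
      using mult_left_mono[OF low[OF m xy] pk(1)] low[OF k fxy] by (simp add: ab mult.assoc)
    show "dist (\<phi> k (\<phi> m x)) (\<phi> k (\<phi> m y)) \<le> b * dist x y"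
      using mult_left_mono[OF up[OF m xy] pk(2)] up[OF k fxy] by (simp add: ab mult.assoc)
  qed
  show False
  proof (rule no_two_disjoint_near_similarities[of W g a b p])
    show "open W" "bounded W" using U(1) by (auto simp: W_def)
    fix t
    have "b-lipschitz_on W (g t)"
      using comp(2) pos by (intro lipschitz_onI) (auto simp: g_def)
    then show "continuous_on W (g t)" by (rule lipschitz_on_continuous_on)
    show "g t ` W \<subseteq> W" using W_in by (auto simp: g_def)
    show "a * dist x y \<le> dist (g t x) (g t y)" if "x \<in> W" "y \<in> W" for x y
      using comp(1) that by (simp add: g_def)
    show "dist p (g t x) \<le> b * dist p x" if "x \<in> W" for x
      using comp(2)[of i j x p] comp(2)[of j i x p] that p by (simp add: g_def dist_commute)
  next
    have "\<phi> i x \<in> U" "\<phi> j x \<in> U" if "x \<in> W" for x using W_in[OF that] by (simp_all add: W_def)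
    then have "g True ` W \<subseteq> \<phi> i ` U" "g False ` W \<subseteq> \<phi> j ` U" by (auto simp: g_def)
    then show "g True ` W \<inter> g False ` W = {}" using U(5) by blast
    have "b / a = ((1 + \<theta>) / (1 - \<theta>)) ^ 2"
      using pos by (simp add: a_def b_def power_divide)
    then show "(b / a) ^ DIM('a) < 2" using \<theta> by simp
  qed (use \<open>W \<noteq> {}\<close> pos in auto)
qed

section \<open>Dyadic digits\<close>

definition dyadic_digit :: "real \<Rightarrow> nat \<Rightarrow> bool" where
  "dyadic_digit t k \<longleftrightarrow> odd \<lfloor>2 ^ Suc k * t\<rfloor>"

lemma dyadic_digits_agree_imp_close:
  assumes t: "t \<in> {0..<1}" "t' \<in> {0..<1}" and agree: "\<And>j. j < k \<Longrightarrow> dyadic_digit t j = dyadic_digit t' j"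
  shows "\<bar>t - t'\<bar> \<le> (1 / 2) ^ k"
proof -
  have half: "\<lfloor>2 * y\<rfloor> div 2 = \<lfloor>y\<rfloor>" for y :: real
    by linarith
  have "\<lfloor>2 ^ k * t\<rfloor> = \<lfloor>2 ^ k * t'\<rfloor>"
    using agree
  proof (induction k)
    case 0
    have "\<lfloor>t\<rfloor> = 0" "\<lfloor>t'\<rfloor> = 0" using t by (simp_all add: floor_eq_iff)
    then show ?case by simp
  next
    case (Suc k)
    then have "\<lfloor>2 ^ Suc k * t\<rfloor> div 2 = \<lfloor>2 ^ Suc k * t'\<rfloor> div 2"
      using half[of "2 ^ k * t"] half[of "2 ^ k * t'"] by (simp add: mult.assoc)
    moreover have "odd \<lfloor>2 ^ Suc k * t\<rfloor> = odd \<lfloor>2 ^ Suc k * t'\<rfloor>"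
      using Suc.prems[of k] by (simp add: dyadic_digit_def)
    ultimately show ?case by presburger
  qed
  then have "\<bar>2 ^ k * t - 2 ^ k * t'\<bar> \<le> 1" by linarith
  then have "2 ^ k * \<bar>t - t'\<bar> \<le> 1" by (simp add: abs_mult flip: right_diff_distrib)
  then show ?thesis by (simp add: power_one_over field_simps)
qed

lemma dyadic_digits_differ:
  assumes t: "t \<in> {0..<1}" "t' \<in> {0..<1}" "t \<noteq> t'"
  shows "\<exists>k. dyadic_digit t k \<noteq> dyadic_digit t' k"
proof (rule ccontr)
  assume "\<not> ?thesis"
  then have "\<bar>t - t'\<bar> \<le> (1 / 2) ^ k" for k
    using dyadic_digits_agree_imp_close[OF t(1,2)] by blast
  moreover obtain k where "(1 / 2) ^ k < \<bar>t - t'\<bar>"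
    using real_arch_pow_inv[of "\<bar>t - t'\<bar>" "1 / 2"] t(3) by auto
  ultimately show False by (meson not_le)
qed

section \<open>Words with free and prescribed blocks\<close>

text \<open>The word records the first \<open>k\<close> bits of \<open>b\<close> by blocks \<open>u\<close> and \<open>v\<close>. After each bit the prescribed
  block \<open>pad n\<close>, where \<open>n\<close> is the current length, is inserted whenever the budget of \<open>M\<close> letters per
  bit allows it. The budget keeps the free blocks at a positive density by construction.\<close>

primrec coded_word ::
  "(nat \<Rightarrow> 'i list) \<Rightarrow> 'i list \<Rightarrow> 'i list \<Rightarrow> nat \<Rightarrow> (nat \<Rightarrow> bool) \<Rightarrow> nat \<Rightarrow> 'i list" where
  "coded_word pad u v M b 0 = []"
| "coded_word pad u v M b (Suc k) =
     (let w = coded_word pad u v M b k @ (if b k then u else v)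
      in if length w + length (pad (length w)) \<le> M * Suc k then w @ pad (length w) else w)"

lemma coded_word_cong:
  "(\<And>j. j < k \<Longrightarrow> b j = b' j) \<Longrightarrow> coded_word pad u v M b k = coded_word pad u v M b' k"
  by (induction k) (auto simp: Let_def)

lemma coded_word_in_lists:
  "u \<in> lists D \<Longrightarrow> v \<in> lists D \<Longrightarrow> (\<And>n. pad n \<in> lists D) \<Longrightarrow> coded_word pad u v M b k \<in> lists D"
  by (induction k) (auto simp: Let_def)

lemma coded_word_Suc_append:
  assumes "u \<in> lists D" "v \<in> lists D" "\<And>n. pad n \<in> lists D"
  shows "\<exists>z\<in>lists D. coded_word pad u v M b (Suc k) = coded_word pad u v M b k @ (if b k then u else v) @ z"
  using assms(3) by (auto simp: Let_def)

lemma length_coded_word_le: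
  assumes "length u \<le> M" "length v \<le> M"
  shows "length (coded_word pad u v M b k) \<le> M * k"
proof (induction k)
  case (Suc k)
  have "length (if b k then u else v) \<le> M" using assms by simp
  with Suc show ?case by (auto simp: Let_def)
qed simp

lemma length_coded_word_ge:
  assumes "u \<noteq> []" "v \<noteq> []"
  shows "k \<le> length (coded_word pad u v M b k)"
proof (induction k)
  case (Suc k)
  have "1 \<le> length (if b k then u else v)" using assms by (simp add: Suc_le_eq)
  with Suc show ?case by (auto simp: Let_def)
qed simp

text \<open>Without insertions the word grows by at most \<open>q\<close> letters per bit, so that the block to be
  inserted has length about \<open>A * q * k\<close>, and the budget \<open>M * k\<close> with \<open>M > (A + 1) * q\<close>
  eventually exceeds what is needed.\<close>

lemma coded_word_padded_infinitely_often:
  assumes q: "length u \<le> q" "length v \<le> q" and pad: "\<And>n. length (pad n) = A * n + B"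
    and M: "M = (A + 1) * q + 1"
  shows "\<exists>k\<ge>k0. \<exists>w. w = coded_word pad u v M b k @ (if b k then u else v) \<and>
    coded_word pad u v M b (Suc k) = w @ pad (length w)"
proof (rule ccontr)
  assume none: "\<not> ?thesis"
  let ?W = "coded_word pad u v M b"
  let ?w = "\<lambda>k. ?W k @ (if b k then u else v)"
  have no: "M * Suc k < length (?w k) + length (pad (length (?w k))) \<and> ?W (Suc k) = ?w k" if "k0 \<le> k" for k
  proof -
    have "?W (Suc k) \<noteq> ?w k @ pad (length (?w k))" using none that by blast
    then show ?thesis by (simp add: Let_def not_le split: if_splits)
  qed
  have blk: "length (?w k) \<le> length (?W k) + q" for k using q by simp
  have len: "length (?W (k0 + n)) \<le> length (?W k0) + q * n" for n
  proof (induction n)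
    case (Suc n)
    have "length (?W (k0 + Suc n)) = length (?w (k0 + n))" using no[of "k0 + n"] by simp
    then show ?case using Suc blk[of "k0 + n"] by simp
  qed simp
  define L where "L = length (?W k0)"
  (* The extra 1 in M gains one letter per bit, so (A + 1) * L + B further bits pay for the constants. *)
  define k where "k = k0 + ((A + 1) * L + B)"
  define Q where "Q = q * Suc ((A + 1) * L + B)"
  have w: "length (?w k) \<le> L + Q"
    using len[of "(A + 1) * L + B"] blk[of k] by (simp add: k_def L_def Q_def)
  have "M * Suc k < (A + 1) * length (?w k) + B"
    using no[of k] pad by (simp add: k_def)
  also have "\<dots> \<le> (A + 1) * (L + Q) + B"
    using w by (intro add_right_mono mult_left_mono) auto
  also have "\<dots> = (A + 1) * Q + ((A + 1) * L + B)" by (simp add: algebra_simps)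
  also have "\<dots> \<le> (A + 1) * (q * Suc k) + Suc k"
  proof (intro add_mono mult_left_mono)
    show "Q \<le> q * Suc k" unfolding Q_def k_def by (intro mult_left_mono) auto
  qed (auto simp: k_def)
  also have "\<dots> = M * Suc k" by (simp add: M algebra_simps)
  finally show False by simp
qed

section \<open>Coding points of a bi-Lipschitz attractor\<close>

primrec word_map :: "('i \<Rightarrow> 'a \<Rightarrow> 'a) \<Rightarrow> 'i list \<Rightarrow> 'a \<Rightarrow> 'a" where
  "word_map \<phi> [] = id"
| "word_map \<phi> (i # w) = \<phi> i \<circ> word_map \<phi> w"

lemma word_map_append: "word_map \<phi> (u @ w) x = word_map \<phi> u (word_map \<phi> w x)"
  by (induction u) auto

locale bilipschitz_attractor =
  fixes \<phi> :: "'i \<Rightarrow> 'a::euclidean_space \<Rightarrow> 'a" and D :: "'i set" and X :: "'a set" and r c :: real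
  assumes compact_X: "compact X" and X_ne: "X \<noteq> {}" and X_eq: "X = (\<Union>i\<in>D. \<phi> i ` X)"
    and r: "0 < r" "r < 1" and c: "0 < c" "c < 1"
    and upper: "\<And>i x y. i \<in> D \<Longrightarrow> x \<in> X \<Longrightarrow> y \<in> X \<Longrightarrow> dist (\<phi> i x) (\<phi> i y) \<le> r * dist x y"
    and lower: "\<And>i x y. i \<in> D \<Longrightarrow> x \<in> X \<Longrightarrow> y \<in> X \<Longrightarrow> c * dist x y \<le> dist (\<phi> i x) (\<phi> i y)"
begin

abbreviation cyl :: "'i list \<Rightarrow> 'a set" where "cyl w \<equiv> word_map \<phi> w ` X"

lemma word_map_in: "w \<in> lists D \<Longrightarrow> x \<in> X \<Longrightarrow> word_map \<phi> w x \<in> X"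
  by (induction w) (use X_eq in auto)

lemma word_map_upper:
  "w \<in> lists D \<Longrightarrow> x \<in> X \<Longrightarrow> y \<in> X \<Longrightarrow> dist (word_map \<phi> w x) (word_map \<phi> w y) \<le> r ^ length w * dist x y"
proof (induction w)
  case (Cons i w)
  then have "dist (word_map \<phi> (i # w) x) (word_map \<phi> (i # w) y) \<le> r * dist (word_map \<phi> w x) (word_map \<phi> w y)"
    using upper word_map_in by simp
  also have "\<dots> \<le> r * (r ^ length w * dist x y)"
    using Cons r by (intro mult_left_mono) auto
  finally show ?case by (simp add: mult.assoc)
qed simp

lemma word_map_lower:
  "w \<in> lists D \<Longrightarrow> x \<in> X \<Longrightarrow> y \<in> X \<Longrightarrow> c ^ length w * dist x y \<le> dist (word_map \<phi> w x) (word_map \<phi> w y)"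
proof (induction w)
  case (Cons i w)
  then have "c * (c ^ length w * dist x y) \<le> c * dist (word_map \<phi> w x) (word_map \<phi> w y)"
    using c by (intro mult_left_mono) auto
  also have "\<dots> \<le> dist (word_map \<phi> (i # w) x) (word_map \<phi> (i # w) y)"
    using lower Cons word_map_in by simp
  finally show ?case by (simp add: mult.assoc)
qed simp

lemma compact_cyl: "w \<in> lists D \<Longrightarrow> compact (cyl w)"
proof (rule compact_continuous_image[OF lipschitz_on_continuous_on compact_X])
  assume "w \<in> lists D"
  then show "(r ^ length w)-lipschitz_on X (word_map \<phi> w)"
    using r word_map_upper by (intro lipschitz_onI) auto
qed

lemma cyl_append: "w \<in> lists D \<Longrightarrow> cyl (u @ w) \<subseteq> cyl u"
  using word_map_in by (auto simp: word_map_append)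

lemma in_cyl_of_length: "x \<in> X \<Longrightarrow> \<exists>w\<in>lists D. length w = m \<and> x \<in> cyl w"
proof (induction m arbitrary: x)
  case (Suc m)
  then obtain i y where iy: "i \<in> D" "y \<in> X" "x = \<phi> i y" using X_eq by blast
  obtain w where w: "w \<in> lists D" "length w = m" "y \<in> cyl w" using Suc.IH[OF iy(2)] by blast
  then show ?case using iy by (intro bexI[of _ "i # w"]) auto
qed (auto intro: bexI[of _ "[]"])

lemma dist_le_diameter: "x \<in> X \<Longrightarrow> y \<in> X \<Longrightarrow> dist x y \<le> diameter X"
  using compact_X by (simp add: compact_imp_bounded diameter_bounded_bound)

lemma exists_small_power: "0 < \<epsilon> \<Longrightarrow> \<exists>n. r ^ n * diameter X < \<epsilon>"
proof -
  assume "0 < \<epsilon>"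
  have d: "0 \<le> diameter X" using diameter_ge_0[OF compact_imp_bounded[OF compact_X]] .
  then have "0 < \<epsilon> / (diameter X + 1)" using \<open>0 < \<epsilon>\<close> by simp
  then obtain n where "r ^ n < \<epsilon> / (diameter X + 1)" using real_arch_pow_inv r by blast
  then have "r ^ n * (diameter X + 1) < \<epsilon>" using d by (simp add: field_simps)
  moreover have "r ^ n * diameter X \<le> r ^ n * (diameter X + 1)" using r by simp
  ultimately show ?thesis by (meson le_less_trans)
qed

lemma disjoint_cylinders:
  assumes "x \<in> X" "y \<in> X" "x \<noteq> y"
  shows "\<exists>u\<in>lists D. \<exists>v\<in>lists D. cyl u \<inter> cyl v = {}"
proof -
  have "0 < dist x y / 2" using assms by simp
  then obtain m where m: "r ^ m * diameter X < dist x y / 2" using exists_small_power by blast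
  obtain u where u: "u \<in> lists D" "length u = m" "x \<in> cyl u" using in_cyl_of_length assms by blast
  obtain v where v: "v \<in> lists D" "length v = m" "y \<in> cyl v" using in_cyl_of_length assms by blast
  have small: "dist a b \<le> r ^ m * diameter X" if "w \<in> lists D" "length w = m" "a \<in> cyl w" "b \<in> cyl w" for w a b
  proof -
    obtain a' b' where ab: "a' \<in> X" "b' \<in> X" "a = word_map \<phi> w a'" "b = word_map \<phi> w b'" using \<open>a \<in> cyl w\<close> \<open>b \<in> cyl w\<close> by auto
    have "dist a b \<le> r ^ m * dist a' b'" using word_map_upper[OF that(1) ab(1,2)] ab that(2) by simp
    also have "\<dots> \<le> r ^ m * diameter X" using ab dist_le_diameter r by (intro mult_left_mono) auto
    finally show ?thesis .
  qed
  have "False" if "a \<in> cyl u" "a \<in> cyl v" for a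
    using small[OF u that(1)] small[OF v that(2)] m dist_triangle2[of x y a] by linarith
  then show ?thesis using u v by blast
qed

text \<open>Two words \<open>u\<close> and \<open>v\<close> with disjoint cylinders encode the binary digits of the parameter. These cylinders are
  at positive distance, so points whose parameters first differ in the binary digit \<open>k\<close> are at a distance of order
  at least \<open>c ^ (M * k)\<close>, while the parameters differ by at most \<open>(1 / 2) ^ k\<close>; that is a Hoelder estimate. The
  inserted block \<open>pad n\<close> is the beginning of a code of \<open>e0\<close>. It has length \<open>A * n + B\<close>, so it brings the
  point within \<open>c0 * \<kappa> ^ n\<close> of the image of \<open>e0\<close> under the word of length \<open>n\<close> before it.\<close>

lemma well_approximable_Hoelder_family:
  assumes e0: "e0 \<in> X" and nontriv: "x0 \<in> X" "y0 \<in> X" "x0 \<noteq> y0"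
    and \<kappa>: "0 < \<kappa>" "\<kappa> < 1" and c0: "0 < c0"
  obtains s K x where "0 < s" "0 < K"
    "\<And>t. t \<in> {0..<1} \<Longrightarrow> x t \<in> X"
    "\<And>t t'. t \<in> {0..<1} \<Longrightarrow> t' \<in> {0..<1} \<Longrightarrow> \<bar>t - t'\<bar> \<le> K * dist (x t) (x t') powr s"
    "\<And>t n. t \<in> {0..<1} \<Longrightarrow>
       \<exists>w\<in>lists D. n \<le> length w \<and> dist (x t) (word_map \<phi> w e0) < c0 * \<kappa> ^ length w"
proof -
  obtain u v where uv: "u \<in> lists D" "v \<in> lists D" "cyl u \<inter> cyl v = {}"
    using disjoint_cylinders[OF nontriv] by blast
  have uv_ne: "u \<noteq> []" "v \<noteq> []"
    using uv X_ne word_map_in by fastforce+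
  obtain \<delta> where \<delta>: "0 < \<delta>" "\<And>x y. x \<in> cyl u \<Longrightarrow> y \<in> cyl v \<Longrightarrow> \<delta> \<le> dist x y"
    using separate_compact_closed[OF compact_cyl compact_imp_closed[OF compact_cyl]] uv by metis
  obtain A where A: "r ^ A < \<kappa>" using real_arch_pow_inv r \<kappa> by blast
  obtain B where B: "r ^ B * diameter X < c0" using exists_small_power c0 by blast
  have "\<forall>m. \<exists>w. w \<in> lists D \<and> length w = m \<and> e0 \<in> cyl w"
    using in_cyl_of_length[OF e0] by blast
  then obtain code where code: "\<forall>m. code m \<in> lists D \<and> length (code m) = m \<and> e0 \<in> cyl (code m)"
    by (rule choice[THEN exE])
  define pad where "pad n = code (A * n + B)" for n
  have pad: "pad n \<in> lists D" "length (pad n) = A * n + B" "e0 \<in> cyl (pad n)" for n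
    using code unfolding pad_def by blast+
  define q where "q = max (length u) (length v)"
  define M where "M = (A + 1) * q + 1"
  have qM: "length u \<le> q" "length v \<le> q" "length u \<le> M" "length v \<le> M"
    by (auto simp: q_def M_def)
  define W where "W t = coded_word pad u v M (dyadic_digit t)" for t
  have W: "W t k \<in> lists D" for t k using uv pad by (simp add: W_def coded_word_in_lists)
  have W_Suc: "\<exists>z\<in>lists D. W t (Suc k) = W t k @ (if dyadic_digit t k then u else v) @ z" for t k
    unfolding W_def by (rule coded_word_Suc_append) (use uv pad in auto)
  have "\<Inter>(range (\<lambda>k. cyl (W t k))) \<noteq> {}" for t
  proof (rule compact_nest)
    show "compact (cyl (W t k))" "cyl (W t k) \<noteq> {}" for k using compact_cyl W X_ne by auto
    have step: "cyl (W t (Suc k)) \<subseteq> cyl (W t k)" for k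
    proof -
      obtain z where z: "z \<in> lists D" "W t (Suc k) = W t k @ (if dyadic_digit t k then u else v) @ z"
        using W_Suc by blast
      show ?thesis unfolding z(2) using z(1) uv by (intro cyl_append) auto
    qed
    show "cyl (W t n) \<subseteq> cyl (W t m)" if "m \<le> n" for m n
      using decseqD[OF decseq_SucI[of "\<lambda>k. cyl (W t k)", OF step] that] .
  qed
  then have "\<forall>t. \<exists>y. \<forall>k. y \<in> cyl (W t k)"
    unfolding ex_in_conv[symmetric] INT_iff by simp
  then obtain x where "\<forall>t k. x t \<in> cyl (W t k)"
    by (rule choice[THEN exE])
  then have x: "x t \<in> cyl (W t k)" for t k by simp
  (* The exponent solves (c ^ M) powr s = 1 / 2, so that k binary digits match M * k letters. *)
  define s where "s = ln 2 / (- (real M * ln c))"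
  have lnc: "ln c < 0" using c by simp
  have "0 < M" by (simp add: M_def)
  then have "real M * ln c < 0" using lnc by (simp add: mult_pos_neg)
  then have s: "0 < s" by (simp add: s_def divide_pos_neg)
  have powr_s: "(c ^ (M * k)) powr s = (1 / 2) ^ k" for k
  proof -
    have "(c ^ (M * k)) powr s = exp (s * (real (M * k) * ln c))"
      using c by (simp add: powr_def ln_realpow)
    also have "s * (real (M * k) * ln c) = real k * ln (1 / 2)"
      using lnc \<open>0 < M\<close> by (simp add: s_def ln_div)
    also have "exp \<dots> = (1 / 2) ^ k" by (simp add: exp_of_nat_mult)
    finally show ?thesis .
  qed
  have sep: "c ^ (M * k) * \<delta> \<le> dist (x t) (x t')"
    if same: "W t k = W t' k" and k: "dyadic_digit t k" "\<not> dyadic_digit t' k" for t t' k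
  proof -
    obtain z where z: "z \<in> lists D" "W t (Suc k) = W t k @ u @ z" using W_Suc[of t k] k by auto
    obtain z' where z': "z' \<in> lists D" "W t' (Suc k) = W t k @ v @ z'" using W_Suc[of t' k] k same by auto
    obtain y where y: "y \<in> X" "x t = word_map \<phi> (W t k) (word_map \<phi> u (word_map \<phi> z y))"
      using x[of t "Suc k"] z(2) by (auto simp: word_map_append)
    obtain y' where y': "y' \<in> X" "x t' = word_map \<phi> (W t k) (word_map \<phi> v (word_map \<phi> z' y'))"
      using x[of t' "Suc k"] z'(2) by (auto simp: word_map_append)
    let ?y = "word_map \<phi> u (word_map \<phi> z y)" and ?y' = "word_map \<phi> v (word_map \<phi> z' y')"
    have yX: "?y \<in> cyl u" "?y' \<in> cyl v" "?y \<in> X" "?y' \<in> X"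
      using word_map_in uv z(1) z'(1) y(1) y'(1) by auto
    have "length (W t k) \<le> M * k" using qM by (simp add: W_def length_coded_word_le)
    then have "c ^ (M * k) * \<delta> \<le> c ^ length (W t k) * dist ?y ?y'"
      using c \<delta>(1) \<delta>(2)[OF yX(1,2)] by (intro mult_mono power_decreasing) auto
    also have "\<dots> \<le> dist (x t) (x t')"
      using word_map_lower[OF W yX(3,4)] y(2) y'(2) by simp
    finally show ?thesis .
  qed
  show thesis
  proof (rule that[of s "1 / \<delta> powr s" x])
    show "0 < s" "0 < 1 / \<delta> powr s" using s \<delta> by auto
    show "x t \<in> X" for t using x[of t 0] by (simp add: W_def)
    show "\<bar>t - t'\<bar> \<le> 1 / \<delta> powr s * dist (x t) (x t') powr s"
      if t: "t \<in> {0..<1}" "t' \<in> {0..<1}" for t t'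
    proof (cases "t = t'")
      case False
      define k where "k = (LEAST k. dyadic_digit t k \<noteq> dyadic_digit t' k)"
      have k: "dyadic_digit t k \<noteq> dyadic_digit t' k"
        unfolding k_def using dyadic_digits_differ[OF t False] by (rule LeastI_ex)
      have agree: "dyadic_digit t j = dyadic_digit t' j" if "j < k" for j
        using not_less_Least that unfolding k_def by blast
      then have same: "W t k = W t' k" unfolding W_def by (rule coded_word_cong)
      have "c ^ (M * k) * \<delta> \<le> dist (x t) (x t')"
      proof (cases "dyadic_digit t k")
        case True
        then show ?thesis using sep[OF same] k by blast
      next
        case False
        then show ?thesis using sep[OF same[symmetric]] k by (simp add: dist_commute)
      qed
      then have "(c ^ (M * k) * \<delta>) powr s \<le> dist (x t) (x t') powr s"
        using s c \<delta> by (intro powr_mono2) auto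
      then have "(1 / 2) ^ k * \<delta> powr s \<le> dist (x t) (x t') powr s"
        using c \<delta> powr_s[of k] by (simp add: powr_mult)
      then have "(1 / 2) ^ k \<le> 1 / \<delta> powr s * dist (x t) (x t') powr s"
        using \<delta> by (simp add: field_simps)
      moreover have "\<bar>t - t'\<bar> \<le> (1 / 2) ^ k"
        using agree by (rule dyadic_digits_agree_imp_close[OF t])
      ultimately show ?thesis by linarith
    qed simp
    show "\<exists>w\<in>lists D. n \<le> length w \<and> dist (x t) (word_map \<phi> w e0) < c0 * \<kappa> ^ length w" for t n
    proof -
      obtain k w where kw: "n \<le> k" "w = W t k @ (if dyadic_digit t k then u else v)"
        "W t (Suc k) = w @ pad (length w)"
        using coded_word_padded_infinitely_often[OF qM(1,2) pad(2) M_def] unfolding W_def by blast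
      have wD: "w \<in> lists D" using kw(2) W uv by auto
      have "k \<le> length (W t k)" using uv_ne by (simp add: W_def length_coded_word_ge)
      then have "n \<le> length w" using kw by simp
      moreover have "dist (x t) (word_map \<phi> w e0) < c0 * \<kappa> ^ length w"
      proof -
        let ?n = "length w" and ?p = "pad (length w)"
        obtain y where y: "y \<in> X" "x t = word_map \<phi> w (word_map \<phi> ?p y)"
          using x[of t "Suc k"] kw(3) by (auto simp: word_map_append)
        obtain z where z: "z \<in> X" "e0 = word_map \<phi> ?p z" using pad(3)[of ?n] by auto
        have "dist (x t) (word_map \<phi> w e0) \<le> r ^ ?n * dist (word_map \<phi> ?p y) (word_map \<phi> ?p z)"
          using word_map_upper[OF wD] word_map_in pad(1) y z by simp
        also have "\<dots> \<le> 1 * dist (word_map \<phi> ?p y) (word_map \<phi> ?p z)"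
          using r by (intro mult_right_mono) (auto simp: power_le_one)
        also have "\<dots> \<le> r ^ length ?p * dist y z"
          using word_map_upper[OF pad(1) y(1) z(1)] by simp
        also have "\<dots> \<le> r ^ length ?p * diameter X"
          using dist_le_diameter y z r by (intro mult_left_mono) auto
        also have "\<dots> = (r ^ A) ^ ?n * (r ^ B * diameter X)"
          by (simp add: pad(2) power_add power_mult)
        also have "\<dots> \<le> \<kappa> ^ ?n * (r ^ B * diameter X)"
          using A r diameter_ge_0[OF compact_imp_bounded[OF compact_X]]
          by (intro mult_right_mono power_mono) auto
        also have "\<dots> < \<kappa> ^ ?n * c0" using B \<kappa> by simp
        finally show ?thesis by (simp add: mult.commute)
      qed
      ultimately show ?thesis using wD by blast
    qed
  qed
qed

end

section \<open>Positive dimension of the set of well approximable points\<close>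

text \<open>The constants are uniform because the index set is finite. The lower one is capped at \<open>1 / 2\<close>, so
  that its powers decrease.\<close>

lemma conformal_attractor_bilipschitz:
  fixes \<phi> :: "'i \<Rightarrow> 'a::euclidean_space \<Rightarrow> 'a"
  assumes ifs: "conformal_ifs Y V D \<phi>" and attr: "attractor_on Y D \<phi> X" and D: "D \<noteq> {}"
  obtains r c where "bilipschitz_attractor \<phi> D X r c"
proof -
  have X: "X \<noteq> {}" "compact X" "X \<subseteq> Y" "X = (\<Union>i\<in>D. \<phi> i ` X)"
    using attr unfolding attractor_on_def by blast+
  have fin: "finite D" using ifs by (simp add: conformal_ifs_def ifs_on_def)
  have "\<exists>r. 0 < r \<and> r < 1 \<and> (\<forall>x\<in>X. \<forall>y\<in>X. dist (\<phi> i x) (\<phi> i y) \<le> r * dist x y)" if "i \<in> D" for i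
  proof -
    have "contraction_on Y (\<phi> i)" using ifs that by (simp add: conformal_ifs_def ifs_on_def)
    then show ?thesis using X(3) unfolding contraction_on_def by blast
  qed
  then obtain R where R: "\<And>i. i \<in> D \<Longrightarrow> 0 < R i" "\<And>i. i \<in> D \<Longrightarrow> R i < 1"
    "\<And>i x y. i \<in> D \<Longrightarrow> x \<in> X \<Longrightarrow> y \<in> X \<Longrightarrow> dist (\<phi> i x) (\<phi> i y) \<le> R i * dist x y"
    by metis
  have "\<exists>c>0. \<forall>x\<in>X. \<forall>y\<in>X. c * dist x y \<le> dist (\<phi> i x) (\<phi> i y)" if i: "i \<in> D" for i
  proof -
    obtain f' where V: "open (V i)" "Y \<subseteq> V i" "inj_on (\<phi> i) (V i)" and conf: "conformal_on (V i) (\<phi> i) f'"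
      and pos: "\<forall>x\<in>V i. 0 < norm (f' x)"
      using conformal_ifs_map[OF ifs i] by blast
    have "X \<subseteq> V i" using V(2) X(3) by blast
    then show ?thesis
      using conformal_lower_Lipschitz_on_compact[OF conf V(1) X(2) _ V(3)] pos by blast
  qed
  then obtain c where c: "\<And>i. i \<in> D \<Longrightarrow> 0 < c i"
    "\<And>i x y. i \<in> D \<Longrightarrow> x \<in> X \<Longrightarrow> y \<in> X \<Longrightarrow> c i * dist x y \<le> dist (\<phi> i x) (\<phi> i y)"
    by metis
  define r where "r = Max (R ` D)"
  define c' where "c' = min (1 / 2) (Min (c ` D))"
  have "bilipschitz_attractor \<phi> D X r c'"
  proof
    have "r \<in> R ` D" unfolding r_def using fin D by (intro Max_in) auto
    then show "0 < r" "r < 1" using R by auto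
    have "Min (c ` D) \<in> c ` D" using fin D by (intro Min_in) auto
    then show "0 < c'" "c' < 1" using c by (auto simp: c'_def)
    fix i x y assume i: "i \<in> D" "x \<in> X" "y \<in> X"
    have "R i \<le> r" unfolding r_def using fin i by simp
    then show "dist (\<phi> i x) (\<phi> i y) \<le> r * dist x y"
      using R(3)[OF i] mult_right_mono[of "R i" r "dist x y"] by simp
    have "Min (c ` D) \<le> c i" using fin i by simp
    then have "c' \<le> c i" by (simp add: c'_def)
    then show "c' * dist x y \<le> dist (\<phi> i x) (\<phi> i y)"
      using c(2)[OF i] mult_right_mono[of c' "c i" "dist x y"] by simp
  qed (use X in auto)
  then show thesis by (rule that)
qed

lemma word_map_respects:
  assumes "\<And>x i. x \<in> E \<Longrightarrow> i \<in> D \<Longrightarrow> \<phi> i x \<in> E" "\<And>x i. x \<in> E \<Longrightarrow> i \<in> D \<Longrightarrow> H (\<phi> i x) < C * H x"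
    and "0 \<le> C" "w \<in> lists D" "e \<in> E"
  shows "word_map \<phi> w e \<in> E \<and> H (word_map \<phi> w e) \<le> C ^ length w * (H e :: real)"
  using assms(4)
proof (induction w)
  case (Cons i w)
  then have IH: "word_map \<phi> w e \<in> E" "H (word_map \<phi> w e) \<le> C ^ length w * H e" and i: "i \<in> D" by auto
  have "H (\<phi> i (word_map \<phi> w e)) \<le> C * H (word_map \<phi> w e)"
    using assms(2)[OF IH(1) i] by simp
  also have "\<dots> \<le> C * (C ^ length w * H e)" using IH(2) assms(3) by (rule mult_left_mono)
  finally show ?case using assms(1) IH(1) i by (simp add: mult.assoc)
qed (use assms(5) in simp)

theorem proposition5p5:
  fixes \<phi> :: "'i \<Rightarrow> 'a::euclidean_space \<Rightarrow> 'a"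
    and D :: "'i set"
    and V :: "'i \<Rightarrow> 'a set"
    and Y X E :: "'a set"
    and H :: "'a \<Rightarrow> real"
    and l :: real
  assumes "conformal_ifs Y V D \<phi>"
    and "2 \<le> card D"
    and "open_set_condition V D \<phi>"
    and "attractor_on Y D \<phi> X"
    and "height_function E H"
    and "E \<inter> X \<noteq> {}"
    and "ifs_respects D \<phi> E H"
    and "0 < l"
  shows "0 < hausdorff_dim {x \<in> X. infinite {e \<in> E. norm (x - e) < H e powr (- l)}}"
proof -
  have fin: "finite D" using assms(1) by (simp add: conformal_ifs_def ifs_on_def)
  have "\<not> card D \<le> Suc 0" using assms(2) by simp
  then obtain i j where ij: "i \<in> D" "j \<in> D" "i \<noteq> j"
    using card_le_Suc0_iff_eq[OF fin] by blast
  obtain r c where "bilipschitz_attractor \<phi> D X r c"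
    using conformal_attractor_bilipschitz[OF assms(1,4)] ij by blast
  then interpret bilipschitz_attractor \<phi> D X r c .
  have "X \<subseteq> Y" using assms(4) by (simp add: attractor_on_def)
  have "\<exists>x0\<in>X. \<exists>y0\<in>X. x0 \<noteq> y0"
  proof (rule ccontr)
    assume one: "\<not> ?thesis"
    obtain p where p: "p \<in> X" using X_ne by blast
    have "\<phi> i p \<in> X" "\<phi> j p \<in> X" using p ij X_eq by blast+
    then have "\<phi> i p = p" "\<phi> j p = p" using one p by blast+
    then show False
      using conformal_ifs_no_common_fixed_point[OF assms(1,3) ij] p \<open>X \<subseteq> Y\<close> by blast
  qed
  then obtain x0 y0 where xy: "x0 \<in> X" "y0 \<in> X" "x0 \<noteq> y0" by blast
  obtain e0 where e0: "e0 \<in> E" "e0 \<in> X" using assms(6) by blast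
  obtain C where C: "1 < C" and CE: "\<And>x i. x \<in> E \<Longrightarrow> i \<in> D \<Longrightarrow> \<phi> i x \<in> E"
    "\<And>x i. x \<in> E \<Longrightarrow> i \<in> D \<Longrightarrow> H (\<phi> i x) < C * H x"
    using assms(7) unfolding ifs_respects_def by metis
  have H0: "0 < H e" if "e \<in> E" for e using assms(5) that by (simp add: height_function_def)
  define \<kappa> where "\<kappa> = C powr (- l)"
  define c0 where "c0 = H e0 powr (- l)"
  have \<kappa>: "0 < \<kappa>" "\<kappa> < 1" and c0: "0 < c0"
    using C H0[OF e0(1)] assms(8) by (auto simp: \<kappa>_def c0_def intro: powr_less_one)
  let ?e = "\<lambda>w. word_map \<phi> w e0"
  have eE: "?e w \<in> E" and eH: "c0 * \<kappa> ^ length w \<le> H (?e w) powr (- l)" if "w \<in> lists D" for w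
  proof -
    have w: "?e w \<in> E" "H (?e w) \<le> C ^ length w * H e0"
      using word_map_respects[where \<phi> = \<phi> and H = H, OF CE _ that e0(1)] C by auto
    then show "?e w \<in> E" by simp
    have "c0 * \<kappa> ^ length w = (C ^ length w * H e0) powr (- l)"
      using C H0[OF e0(1)] by (simp add: c0_def \<kappa>_def powr_mult powr_power flip: powr_realpow powr_powr) (simp add: powr_powr mult.commute)
    also have "\<dots> \<le> H (?e w) powr (- l)"
      using w H0[OF w(1)] assms(8) by (intro powr_mono2') auto
    finally show "c0 * \<kappa> ^ length w \<le> H (?e w) powr (- l)" .
  qed
  obtain s K x where s: "0 < s" "0 < K" and x: "\<And>t. t \<in> {0..<1} \<Longrightarrow> x t \<in> X"
    and hoelder: "\<And>t t'. t \<in> {0..<1} \<Longrightarrow> t' \<in> {0..<1} \<Longrightarrow> \<bar>t - t'\<bar> \<le> K * dist (x t) (x t') powr s"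
    and approx: "\<And>t n. t \<in> {0..<1} \<Longrightarrow> \<exists>w\<in>lists D. n \<le> length w \<and> dist (x t) (?e w) < c0 * \<kappa> ^ length w"
    using well_approximable_Hoelder_family[OF e0(2) xy \<kappa> c0] by blast
  define N where "N = {t \<in> {0..<1}. x t \<in> ?e ` lists D}"
  (* For t in N the point x t may coincide with all the points of E that approximate it. *)
  have "countable N"
  proof (rule countable_image_inj_on)
    have "countable (?e ` lists D)" using fin by (simp add: countable_finite)
    then show "countable (x ` N)" by (rule countable_subset[rotated]) (auto simp: N_def)
    show "inj_on x N"
    proof (rule inj_onI)
      fix t t' assume "t \<in> N" "t' \<in> N" "x t = x t'"
      then show "t = t'" using hoelder[of t t'] s by (simp add: N_def)
    qed
  qed
  moreover have "x t \<in> {x \<in> X. infinite {e \<in> E. norm (x - e) < H e powr (- l)}}"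
    if t: "t \<in> {0..<1} - N" for t
  proof -
    let ?F = "{e \<in> E. norm (x t - e) < H e powr (- l)}"
    have "infinite ?F"
    proof
      assume "finite ?F"
      then obtain d where d: "0 < d" "\<And>e. e \<in> ?F \<Longrightarrow> e \<noteq> x t \<Longrightarrow> d \<le> dist (x t) e"
        using finite_set_avoid[of ?F "x t"] by blast
      obtain n where n: "\<kappa> ^ n < d / c0"
        using real_arch_pow_inv[of "d / c0" \<kappa>] d \<kappa> c0 by auto
      obtain w where w: "w \<in> lists D" "n \<le> length w" "dist (x t) (?e w) < c0 * \<kappa> ^ length w"
        using approx[of t n] t by auto
      have "?e w \<in> ?F" using eE[OF w(1)] eH[OF w(1)] w(3) by (simp add: dist_norm)
      moreover have "?e w \<noteq> x t" using t w(1) unfolding N_def by force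
      ultimately have "d \<le> dist (x t) (?e w)" using d by blast
      also have "\<dots> < c0 * \<kappa> ^ length w" by (rule w(3))
      also have "\<dots> \<le> c0 * \<kappa> ^ n"
        using w(2) c0 \<kappa> by (intro mult_left_mono power_decreasing) auto
      also have "\<dots> < d" using n c0 by (simp add: field_simps)
      finally show False .
    qed
    then show ?thesis using x t by blast
  qed
  ultimately have "ennreal s \<le> hausdorff_dim {x \<in> X. infinite {e \<in> E. norm (x - e) < H e powr (- l)}}"
    using hoelder s by (intro hausdorff_dim_ge_inverse_Hoelder[where N = N and x = x and K = K]) blast+
  moreover have "0 < ennreal s" using s by simp
  ultimately show ?thesis by (rule order.strict_trans2[rotated])
qed

end
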